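(* Let $X$ and $Y$ be Banach spaces and let $C\subseteq X$ and $D\subseteq Y$ be nonempty, closed and convex subsets. Let $(U,\succcurlyeq)$ be a partially ordered vector space. Let $\varphi:C\to U$ and $\psi:D\to U$ be $\succcurlyeq$-continuous operators and let $A:X\to Y$ be a bounded linear operator satisfying: (a1) $AC=D$; (a2)$'$ $A$ is convexity order reserved with respect to $\varphi$ and $\psi$ on $C$ and $D$. Suppose that there is a point $(x_0,Ax_0)\in C\times D$ such that the set $$\{(x',Ax')\in C\times D:\ \varphi(x')\preccurlyeq\varphi(x_0)\ \text{ and }\ \psi(Ax')\preccurlyeq\psi(Ax_0)\}$$ is compact. Then the ordered split convex minimization problem associated with $\varphi,C,A,\psi,D,U$ has a solution; that is, there is $x_*\in C$ such that $\varphi(x_* )\preccurlyeq\varphi(x)$ for all $x\in C$, and such that the point $y_*=Ax_*\in D$ satisfies $\psi(y_* )\preccurlyeq\psi(y)$ for all $y\in D$.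
   Context: A partially ordered vector space $(U,\succcurlyeq)$ is a topological vector space $U$ with a partial order $\succcurlyeq$ such that (1) for every $u\in U$ the sets $\{x\in U:x\preccurlyeq u\}$ and $\{x\in U:x\succcurlyeq u\}$ are closed, and (2) $v\succcurlyeq u$ implies $\alpha v\succcurlyeq\alpha u$ for all $\alpha\ge 0$ and $v+w\succcurlyeq u+w$ for all $w\in U$. An operator $\varphi:C\to U$ is $\succcurlyeq$-continuous if, for every $u\in U$, the sets $\{x\in C:\varphi(x)\preccurlyeq u\}$ and $\{x\in C:\varphi(x)\succcurlyeq u\}$ are closed; similarly for $\psi:D\to U$. $AC=\{Ax:x\in C\}$. $X\times Y$ carries the product topology. A strictly linear combination of $x_1,\dots,x_n$ is a vector $\sum_{i=1}^n\lambda_i x_i$ with $0<\lambda_1,\dots,\lambda_n<1$ and $\sum_{i=1}^n\lambda_i=1$. $A$ is convexity order reserved with respect to $\varphi$ and $\psi$ on $C$ and $D$ if, for any vectors $x_1,\dots,x_n$ in $C$ and any strictly linear combination $x'=\sum_{i=1}^n\lambda_i x_i$, there is a positive integer $j\le n$ such that $\varphi(x')\preccurlyeq\varphi(x_j)$ and $\psi(Ax')\preccurlyeq\psi(Ax_j)$. *)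

theory Defs
  imports "HOL-Analysis.Analysis"
begin

class topological_real_vector = real_vector + topological_ab_group_add +
  assumes tendsto_scaleR_nhds_Pair:
    "LIM p (nhds a \<times>\<^sub>F nhds x). fst p *\<^sub>R snd p :> nhds (a *\<^sub>R x)"

text \<open>
  Translation invariance of the order is the axiom \<open>add_left_mono\<close> inherited from
  \<open>ordered_ab_group_add\<close>.  The two closedness axioms make every singleton closed, so the
  space is automatically Hausdorff.
\<close>

class partially_ordered_tvs = topological_real_vector + ordered_ab_group_add +
  assumes closed_lower_set: "closed {x. x \<le> u}"
    and closed_upper_set: "closed {x. u \<le> x}"
    and scaleR_nonneg_mono: "u \<le> v \<Longrightarrow> 0 \<le> a \<Longrightarrow> a *\<^sub>R u \<le> a *\<^sub>R v"

instance partially_ordered_tvs \<subseteq> ordered_real_vector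
proof
  fix a b :: real and x y :: 'a
  show "a *\<^sub>R x \<le> a *\<^sub>R y" if "x \<le> y" "0 \<le> a"
    using that by (rule scaleR_nonneg_mono)
  show "a *\<^sub>R x \<le> b *\<^sub>R x" if "a \<le> b" "0 \<le> x"
    using scaleR_nonneg_mono[of 0 x "b - a"] that by (simp add: scaleR_left_diff_distrib)
qed

text \<open>
  An operator on a subset \<open>S\<close> is represented by a total function of which only the values
  on \<open>S\<close> are used; closedness of the two level sets is relative to \<open>S\<close>.
\<close>

definition order_continuous_on ::
    "'a::topological_space set \<Rightarrow> ('a \<Rightarrow> 'u::partially_ordered_tvs) \<Rightarrow> bool"
  where "order_continuous_on S f \<longleftrightarrow>
    (\<forall>u. closedin (top_of_set S) {x \<in> S. f x \<le> u} \<and>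
         closedin (top_of_set S) {x \<in> S. u \<le> f x})"

text \<open>The vectors \<open>x 1, \<dots>, x n\<close> need not be distinct.\<close>

definition strictly_linear_combination ::
    "nat \<Rightarrow> (nat \<Rightarrow> 'a::real_vector) \<Rightarrow> 'a \<Rightarrow> bool"
  where "strictly_linear_combination n x x' \<longleftrightarrow>
    (\<exists>l :: nat \<Rightarrow> real. (\<forall>i\<in>{1..n}. 0 < l i \<and> l i < 1) \<and> (\<Sum>i=1..n. l i) = 1 \<and>
       x' = (\<Sum>i=1..n. l i *\<^sub>R x i))"

text \<open>
  The set \<open>D\<close> does not occur as a parameter: \<open>\<psi>\<close> is evaluated only on the image of \<open>C\<close>
  under \<open>A\<close>, which is \<open>D\<close> wherever this notion is used.
\<close>

definition convexity_order_reserved ::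
    "('a::real_vector \<Rightarrow> 'b) \<Rightarrow> ('a \<Rightarrow> 'u::order) \<Rightarrow> ('b \<Rightarrow> 'u) \<Rightarrow> 'a set \<Rightarrow> bool"
  where "convexity_order_reserved A \<phi> \<psi> C \<longleftrightarrow>
    (\<forall>n x x'. (\<forall>i\<in>{1..n}. x i \<in> C) \<and> strictly_linear_combination n x x' \<longrightarrow>
       (\<exists>j\<in>{1..n}. \<phi> x' \<le> \<phi> (x j) \<and> \<psi> (A x') \<le> \<psi> (A (x j))))"

definition ordered_split_min_solution ::
    "('a \<Rightarrow> 'u::order) \<Rightarrow> 'a set \<Rightarrow> ('a \<Rightarrow> 'b) \<Rightarrow> ('b \<Rightarrow> 'u) \<Rightarrow> 'b set \<Rightarrow> 'a \<Rightarrow> bool"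
  where "ordered_split_min_solution \<phi> C A \<psi> D x \<longleftrightarrow>
    x \<in> C \<and> (\<forall>z\<in>C. \<phi> x \<le> \<phi> z) \<and> A x \<in> D \<and> (\<forall>y\<in>D. \<psi> (A x) \<le> \<psi> y)"

end

theory Submission
  imports Defs
begin

text \<open>
  Write \<open>w \<sqsubseteq> z\<close> if \<open>\<phi> w \<le> \<phi> z\<close> and \<open>\<psi> (A w) \<le> \<psi> (A z)\<close>. For \<open>x, y \<in> C\<close> the hypothesis on
  \<open>A\<close> covers the segment from \<open>x\<close> to \<open>y\<close> by the closed lower sets of \<open>x\<close> and of \<open>y\<close>; as the segment
  is connected, these meet, so \<open>x\<close> and \<open>y\<close> have a common lower bound in \<open>C\<close>. Hence the lower sets
  are directed, and compactness of the lower set of \<open>x0\<close> gives a point in all of them. Neither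
  the KKM theorem nor a fixed point theorem is needed.
\<close>

text \<open>An interior point of the segment is a strictly linear combination of the two ends, so
  the hypothesis with \<open>n = 2\<close> applies. The ends themselves would need a weight 0 or 1;
  there reflexivity suffices.\<close>

lemma convexity_order_reserved_segment:
  assumes res: "convexity_order_reserved A \<phi> \<psi> C"
    and "x \<in> C" "y \<in> C" "w \<in> closed_segment x y"
  shows "\<phi> w \<le> \<phi> x \<and> \<psi> (A w) \<le> \<psi> (A x) \<or> \<phi> w \<le> \<phi> y \<and> \<psi> (A w) \<le> \<psi> (A y)"
proof (cases "w = x \<or> w = y")
  case True
  then show ?thesis by auto
next
  case False
  then have "w \<in> open_segment x y"
    using assms(4) by (simp add: open_segment_def)
  then obtain u where u: "0 < u" "u < 1" and w: "w = (1 - u) *\<^sub>R x + u *\<^sub>R y"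
    by (auto simp: in_segment)
  have I: "{1..2::nat} = {1, 2}" by auto
  define p where "p i = (if i = 1 then x else y)" for i :: nat
  define l where "l i = (if i = 1 then 1 - u else u)" for i :: nat
  have "strictly_linear_combination 2 p w"
    unfolding strictly_linear_combination_def I
    by (rule exI[of _ l]) (use u in \<open>simp add: l_def p_def w\<close>)
  moreover have "\<forall>i\<in>{1..2}. p i \<in> C"
    using assms(2,3) by (simp add: p_def)
  ultimately obtain j where "\<phi> w \<le> \<phi> (p j) \<and> \<psi> (A w) \<le> \<psi> (A (p j))"
    using res unfolding convexity_order_reserved_def by blast
  then show ?thesis by (auto simp: p_def split: if_splits)
qed

lemma order_continuous_on_closed_lower:
  assumes "order_continuous_on S f" "closed S"
  shows "closed {x \<in> S. f x \<le> u}"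
  using assms unfolding order_continuous_on_def by (blast intro: closedin_closed_trans)

text \<open>\<open>F z\<close> stands for the lower set of \<open>z\<close> in a preorder on
  \<open>C\<close>. Directedness gives lower bounds of finite families, and the finite intersection
  property inside \<open>F x0\<close> extends this to all of \<open>C\<close>.\<close>

lemma exists_least_of_downward_directed:
  fixes F :: "'a \<Rightarrow> 'a::t2_space set"
  assumes closed: "\<And>z. z \<in> C \<Longrightarrow> closed (F z)"
    and x0: "x0 \<in> C" "compact (F x0)"
    and refl: "\<And>z. z \<in> C \<Longrightarrow> z \<in> F z"
    and trans: "\<And>x y. y \<in> C \<Longrightarrow> x \<in> F y \<Longrightarrow> F x \<subseteq> F y"
    and directed: "\<And>x y. x \<in> C \<Longrightarrow> y \<in> C \<Longrightarrow> \<exists>w\<in>C. w \<in> F x \<inter> F y"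
  shows "\<exists>x\<in>F x0. \<forall>z\<in>C. x \<in> F z"
proof -
  have lower_bound: "\<exists>w\<in>C. w \<in> F x0 \<and> (\<forall>z\<in>I. w \<in> F z)" if "finite I" "I \<subseteq> C" for I
    using that
  proof (induction I rule: finite_induct)
    case empty
    then show ?case using x0 refl by auto
  next
    case (insert a I)
    then obtain w where w: "w \<in> C" "w \<in> F x0" "\<forall>z\<in>I. w \<in> F z" by auto
    \<comment> \<open>A point below both \<open>a\<close> and the old bound \<open>w\<close> is, by
      transitivity, below everything \<open>w\<close> was below, including
      \<open>x0\<close>.\<close>
    obtain v where v: "v \<in> C" "v \<in> F a \<inter> F w"
      using directed[of a w] insert.prems w(1) by auto
    have "v \<in> F z" if "z \<in> C" "w \<in> F z" for z
      using trans[OF that] v(2) by auto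
    then show ?case
      using v w(2,3) x0(1) insert.prems by (intro bexI[of _ v]) auto
  qed
  have "F x0 \<inter> \<Inter> (F ` C) \<noteq> {}"
  proof (rule compact_imp_fip_image[OF x0(2) closed])
    fix I assume "finite I" "I \<subseteq> C"
    then show "F x0 \<inter> \<Inter> (F ` I) \<noteq> {}" using lower_bound[of I] by blast
  qed
  then show ?thesis by blast
qed

theorem theorem4p1:
  fixes C :: "'x::banach set"
    and D :: "'y::banach set"
    and \<phi> :: "'x \<Rightarrow> 'u::partially_ordered_tvs"
    and \<psi> :: "'y \<Rightarrow> 'u"
    and A :: "'x \<Rightarrow> 'y"
    and x0 :: 'x
  assumes "C \<noteq> {}" and "closed C" and "convex C"
    and "D \<noteq> {}" and "closed D" and "convex D"
    and "order_continuous_on C \<phi>" and "order_continuous_on D \<psi>"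
    and "bounded_linear A"
    and "A ` C = D"
    and "convexity_order_reserved A \<phi> \<psi> C"
    and "(x0, A x0) \<in> C \<times> D"
    and "compact {(x', A x') | x'. (x', A x') \<in> C \<times> D \<and> \<phi> x' \<le> \<phi> x0 \<and> \<psi> (A x') \<le> \<psi> (A x0)}"
  shows "\<exists>x. ordered_split_min_solution \<phi> C A \<psi> D x"
proof -
  define F where "F z = {x \<in> C. \<phi> x \<le> \<phi> z \<and> \<psi> (A x) \<le> \<psi> (A z)}" for z
  have AC: "A x \<in> D" if "x \<in> C" for x
    using that \<open>A ` C = D\<close> by auto
  have closed_F: "closed (F z)" for z
  proof -
    \<comment> \<open>The condition \<open>A x \<in> D\<close> hidden in this preimage costs nothing
      on \<open>C\<close>, by \<open>AC\<close>.\<close>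
    have "closed (A -` {y \<in> D. \<psi> y \<le> \<psi> (A z)})"
      using order_continuous_on_closed_lower[OF \<open>order_continuous_on D \<psi>\<close> \<open>closed D\<close>]
        linear_continuous_on[OF \<open>bounded_linear A\<close>, of UNIV]
      by (blast intro: closed_vimage)
    then have "closed ({x \<in> C. \<phi> x \<le> \<phi> z} \<inter> A -` {y \<in> D. \<psi> y \<le> \<psi> (A z)})"
      using order_continuous_on_closed_lower[OF \<open>order_continuous_on C \<phi>\<close> \<open>closed C\<close>] by blast
    also have "{x \<in> C. \<phi> x \<le> \<phi> z} \<inter> A -` {y \<in> D. \<psi> y \<le> \<psi> (A z)} = F z"
      using AC by (auto simp: F_def)
    finally show ?thesis .
  qed
  \<comment> \<open>The compact set of the hypothesis is the graph of \<open>A\<close> over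
    \<open>F x0\<close>; the continuous first projection carries compactness to
    \<open>F x0\<close>.\<close>
  have "F x0 = fst ` {(x', A x') | x'. (x', A x') \<in> C \<times> D \<and> \<phi> x' \<le> \<phi> x0 \<and> \<psi> (A x') \<le> \<psi> (A x0)}"
    using AC by (force simp: F_def)
  then have compact_F: "compact (F x0)"
    using compact_continuous_image[OF continuous_on_fst[OF continuous_on_id] assms(13)] by simp
  have directed: "\<exists>w\<in>C. w \<in> F x \<inter> F y" if xy: "x \<in> C" "y \<in> C" for x y
  proof -
    have seg: "closed_segment x y \<subseteq> C"
      using \<open>convex C\<close> xy by (simp add: closed_segment_subset)
    then have "closed_segment x y \<subseteq> F x \<union> F y"
      using convexity_order_reserved_segment[OF \<open>convexity_order_reserved A \<phi> \<psi> C\<close> xy]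
      by (auto simp: F_def)
    \<comment> \<open>Each end lies in its own lower set, so disjoint traces of \<open>F x\<close>
      and \<open>F y\<close> would disconnect the segment.\<close>
    moreover have "F x \<inter> closed_segment x y \<noteq> {}" "F y \<inter> closed_segment x y \<noteq> {}"
      using xy by (auto simp: F_def)
    ultimately have "F x \<inter> F y \<inter> closed_segment x y \<noteq> {}"
      using connected_segment(1)[of x y] closed_F unfolding connected_closed by blast
    then show ?thesis using seg by auto
  qed
  have "\<exists>x\<in>F x0. \<forall>z\<in>C. x \<in> F z"
  proof (rule exists_least_of_downward_directed)
    show "x0 \<in> C" using assms(12) by simp
  qed (use closed_F compact_F directed in \<open>auto simp: F_def intro: order_trans\<close>)
  then obtain x where "x \<in> C" "\<forall>z\<in>C. x \<in> F z" by (auto simp: F_def)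
  \<comment> \<open>Each point of \<open>D\<close> is \<open>A z\<close> for some \<open>z\<close>
    in \<open>C\<close>, so the bound on \<open>\<psi>\<close> over \<open>C\<close> reaches all of
    \<open>D\<close>.\<close>
  then have "ordered_split_min_solution \<phi> C A \<psi> D x"
    using \<open>A ` C = D\<close> by (auto simp: ordered_split_min_solution_def F_def)
  then show ?thesis ..
qed

end
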